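(* Let $\Phi$, $\varphi$, $V$ be as in the standing assumption (see context), and suppose that $\varphi\in\mathcal Z(\mathbb R^d)$ is radially symmetric. Then there exists a function $v:[0,\infty)\to\mathbb R$ such that $V(x)=v(|x|)$ for all $x\in\mathbb R^d$.
   Context: Notation: $B_r(a)$ is the open ball in $\mathbb R^d$; $D_hf(x)=f(x+h)-2f(x)+f(x-h)$. $\Phi$ is a complete Bernstein function with Lévy pair $(0,\mu)$: $\Phi(u)=\int_0^\infty(1-e^{-ut})\mu(t)\,dt$ with $\mu:(0,\infty)\to[0,\infty)$ completely monotone and $\int_0^\infty\min(1,t)\mu(t)\,dt<\infty$. The jump kernel is $j(r)=(4\pi)^{-d/2}\int_0^\infty t^{-d/2}e^{-r^2/(4t)}\mu(t)\,dt$, $r>0$. $\Phi(-\Delta)$ is the operator on $L^2(\mathbb R^d)$ with Fourier multiplier $\Phi(|y|^2)$. Standing assumption: $V:\mathbb R^d\to\mathbb R$ is a potential, $H=\Phi(-\Delta)+V$, and $\varphi\in L^2(\mathbb R^d)\cap L^\infty(\mathbb R^d)$, $\varphi>0$, satisfies $H\varphi=0$. The potential is understood through the pointwise expression $V(x)=-\frac{1}{\varphi(x)}\Phi(-\Delta)\varphi(x)=\frac{1}{2\varphi(x)}\int_{\mathbb R^d}D_h\varphi(x)\,j(|h|)\,dh$. Space: $\mathcal Z(\mathbb R^d)$ is the set of $f\in L^\infty(\mathbb R^d)$ for which there exist functions $L_f,R_f:\mathbb R^d\to(0,\infty)$ such that $|D_hf(x)|\le L_f(x)|h|^2$ for all $x\in\mathbb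 R^d$ and $h\in B_{R_f(x)}(0)$. *)

theory Defs
  imports "HOL-Analysis.Analysis"
begin

text \<open>
  Throughout, \<open>\<real>\<^sup>d\<close> is \<open>real ^ 'n\<close> with \<open>d = CARD('n)\<close>. Functions on \<open>(0,\<infinity>)\<close> are total functions
  on the reals of which only the values at positive arguments are used.
\<close>

definition completely_monotone :: "(real \<Rightarrow> real) \<Rightarrow> bool" where
  "completely_monotone m \<longleftrightarrow>
     (\<forall>k. \<forall>t>0. (deriv ^^ k) m differentiable (at t) \<and> (-1) ^ k * (deriv ^^ k) m t \<ge> 0)"

text \<open>Complete Bernstein functions with Levy pair \<open>(0, m)\<close>, i.e. without drift and killing terms.\<close>

definition complete_bernstein :: "(real \<Rightarrow> real) \<Rightarrow> (real \<Rightarrow> real) \<Rightarrow> bool" where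
  "complete_bernstein \<Phi> m \<longleftrightarrow>
     completely_monotone m \<and>
     set_integrable lborel {0<..} (\<lambda>t. min 1 t * m t) \<and>
     (\<forall>u\<ge>0. \<Phi> u = (LINT t:{0<..}|lborel. (1 - exp (- u * t)) * m t))"

definition jump_kernel :: "nat \<Rightarrow> (real \<Rightarrow> real) \<Rightarrow> real \<Rightarrow> real" where
  "jump_kernel d m r =
     (4 * pi) powr (- real d / 2) *
     (LINT t:{0<..}|lborel. t powr (- real d / 2) * exp (- r\<^sup>2 / (4 * t)) * m t)"

definition second_diff :: "'a::ab_group_add \<Rightarrow> ('a \<Rightarrow> real) \<Rightarrow> 'a \<Rightarrow> real" where
  "second_diff h f x = f (x + h) - 2 * f x + f (x - h)"

definition L2_space :: "(real ^ 'n \<Rightarrow> 'b::{banach, second_countable_topology}) set" where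
  "L2_space = {f \<in> borel_measurable lebesgue. integrable lebesgue (\<lambda>x. (norm (f x))\<^sup>2)}"

definition Linf_space :: "(real ^ 'n \<Rightarrow> real) set" where
  "Linf_space = {f \<in> borel_measurable lebesgue. \<exists>C. AE x in lebesgue. \<bar>f x\<bar> \<le> C}"

definition Z_space :: "(real ^ 'n \<Rightarrow> real) set" where
  "Z_space = {f \<in> Linf_space.
     \<exists>L R. (\<forall>x. L x > 0 \<and> R x > 0) \<and>
       (\<forall>x. \<forall>h \<in> ball 0 (R x). \<bar>second_diff h f x\<bar> \<le> L x * (norm h)\<^sup>2)}"

definition fourier_L1 :: "(real ^ 'n \<Rightarrow> complex) \<Rightarrow> real ^ 'n \<Rightarrow> complex" where
  "fourier_L1 f y =
     complex_of_real ((2 * pi) powr (- real CARD('n) / 2)) *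
     (LINT x|lebesgue. cis (- (x \<bullet> y)) * f x)"

definition L2_tendsto :: "(nat \<Rightarrow> real ^ 'n \<Rightarrow> complex) \<Rightarrow> (real ^ 'n \<Rightarrow> complex) \<Rightarrow> bool" where
  "L2_tendsto F f \<longleftrightarrow> (\<lambda>k. \<integral>\<^sup>+ x. ennreal ((norm (F k x - f x))\<^sup>2) \<partial>lebesgue) \<longlonglongrightarrow> 0"

text \<open>
  The graph of the Fourier transform on \<open>L\<^sup>2\<close>: the extension by continuity of the Fourier integral
  from \<open>L\<^sup>1 \<inter> L\<^sup>2\<close>. The phase has no factor \<open>2\<pi>\<close>, so that \<open>-\<Delta>\<close> has multiplier \<open>|y|\<^sup>2\<close>.
\<close>

definition L2_fourier :: "(real ^ 'n \<Rightarrow> complex) \<Rightarrow> (real ^ 'n \<Rightarrow> complex) \<Rightarrow> bool" where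
  "L2_fourier f g \<longleftrightarrow> f \<in> L2_space \<and> g \<in> L2_space \<and>
     (\<exists>F. (\<forall>k. F k \<in> L2_space \<and> integrable lebesgue (F k)) \<and>
       L2_tendsto F f \<and> L2_tendsto (\<lambda>k. fourier_L1 (F k)) g)"

text \<open>
  Graphs of the unbounded operators \<open>\<Phi>(-\<Delta>)\<close> and \<open>H = \<Phi>(-\<Delta>) + V\<close> on \<open>L\<^sup>2\<close>, respectively: the
  relations state that \<open>f\<close> lies in the domain and that its image is \<open>g\<close> (up to null sets). The domain
  of \<open>H\<close> is the intersection of the domains of \<open>\<Phi>(-\<Delta>)\<close> and of multiplication by \<open>V\<close>.
\<close>

definition Phi_laplacian ::
  "(real \<Rightarrow> real) \<Rightarrow> (real ^ 'n \<Rightarrow> complex) \<Rightarrow> (real ^ 'n \<Rightarrow> complex) \<Rightarrow> bool" where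
  "Phi_laplacian \<Phi> f g \<longleftrightarrow>
     (\<exists>F. L2_fourier f F \<and> L2_fourier g (\<lambda>y. complex_of_real (\<Phi> ((norm y)\<^sup>2)) * F y))"

definition schroedinger_op ::
  "(real \<Rightarrow> real) \<Rightarrow> (real ^ 'n \<Rightarrow> real) \<Rightarrow> (real ^ 'n \<Rightarrow> complex) \<Rightarrow> (real ^ 'n \<Rightarrow> complex) \<Rightarrow> bool" where
  "schroedinger_op \<Phi> V f g \<longleftrightarrow>
     (\<lambda>x. complex_of_real (V x) * f x) \<in> L2_space \<and>
     (\<exists>k. Phi_laplacian \<Phi> f k \<and> (AE x in lebesgue. g x = k x + complex_of_real (V x) * f x))"

text \<open>The potential as an everywhere defined function, given by its pointwise expression.\<close>

definition pointwise_potential :: "(real \<Rightarrow> real) \<Rightarrow> (real ^ 'n \<Rightarrow> real) \<Rightarrow> real ^ 'n \<Rightarrow> real" where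
  "pointwise_potential m \<phi> x =
     1 / (2 * \<phi> x) * (LINT h|lebesgue. second_diff h \<phi> x * jump_kernel CARD('n) m (norm h))"

definition radially_symmetric :: "(real ^ 'n \<Rightarrow> real) \<Rightarrow> bool" where
  "radially_symmetric f \<longleftrightarrow> (\<exists>\<rho>. \<forall>x. f x = \<rho> (norm x))"

end

theory Submission
  imports Defs
begin

text \<open>
  The potential is built from \<open>\<phi>\<close>, from the radial kernel \<open>j(|h|)\<close> and from Lebesgue measure, and an
  orthogonal transformation \<open>T\<close> preserves all three: in the integral that defines \<open>V(T x)\<close>, the
  substitution \<open>h \<mapsto> T h\<close> makes the integrand \<open>D\<^sub>T\<^sub>h \<phi>(T x) j(|T h|) = D\<^sub>h \<phi>(x) j(|h|)\<close>, so that
  \<open>V \<circ> T = V\<close> (\<open>pointwise_potential_orthogonal_invariant\<close>). Since the orthogonal group acts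
  transitively on every sphere around the origin, \<open>V(x)\<close> depends on \<open>|x|\<close> alone.

  The substitution rests on the invariance of Lebesgue measure under orthogonal transformations
  (\<open>lborel_distr_orthogonal_transformation\<close>). It is derived from translation invariance and the fact
  that \<open>T\<close> maps the unit ball onto itself, in the manner of the uniqueness proof for Haar measure.
\<close>

lemma nn_integral_lborel_translate:
  fixes f :: "'a::euclidean_space \<Rightarrow> ennreal"
  assumes [measurable]: "f \<in> borel_measurable borel"
  shows "(\<integral>\<^sup>+x. f (c + x) \<partial>lborel) = (\<integral>\<^sup>+x. f x \<partial>lborel)"
proof -
  have "(\<integral>\<^sup>+x. f x \<partial>lborel) = (\<integral>\<^sup>+x. f x \<partial>distr lborel borel ((+) c))"
    by (simp only: lborel_distr_plus)
  also have "\<dots> = (\<integral>\<^sup>+x. f (c + x) \<partial>lborel)"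
    by (rule nn_integral_distr) auto
  finally show ?thesis ..
qed

lemma borel_measurable_orthogonal_transformation:
  fixes T :: "'a::euclidean_space \<Rightarrow> 'a"
  assumes "orthogonal_transformation T"
  shows "T \<in> borel_measurable borel"
  using assms
  by (intro borel_measurable_continuous_onI linear_continuous_on
      linear_linear[THEN iffD2] orthogonal_transformation_linear)

text \<open>
  The image of Lebesgue measure under \<open>T\<close> is again translation invariant, and two locally
  finite translation invariant measures are proportional. For a Borel set \<open>A\<close> and the unit ball \<open>B\<close>, the double
  integral of \<open>1\<^sub>B(x) 1\<^sub>A(T y)\<close> is turned by translations in one variable at a time, with
  Tonelli in between, into that of \<open>1\<^sub>B(- T y) 1\<^sub>A(x)\<close>. As \<open>T\<close> is isometric and \<open>B\<close> symmetric,
  \<open>1\<^sub>B(- T y) = 1\<^sub>B(y)\<close>, so the constant of proportionality is 1.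
\<close>
lemma lborel_distr_orthogonal_transformation:
  fixes T :: "'a::euclidean_space \<Rightarrow> 'a"
  assumes T: "orthogonal_transformation T"
  shows "distr lborel borel T = lborel"
proof (rule measure_eqI)
  have [measurable]: "T \<in> borel_measurable borel"
    using T by (rule borel_measurable_orthogonal_transformation)
  have add: "T (x + y) = T x + T y" for x y
    using T by (simp add: linear_add orthogonal_transformation_linear)
  obtain S where TS: "T (S x) = x" for x
    using orthogonal_transformation_surj[OF T] by (metis surjD)
  fix A assume "A \<in> sets (distr lborel borel T)"
  then have [measurable]: "A \<in> sets borel"
    by simp
  define b where "b = (indicator (ball 0 1) :: 'a \<Rightarrow> ennreal)"
  define a where "a = (indicator A :: 'a \<Rightarrow> ennreal)"
  have [measurable]: "b \<in> borel_measurable borel" "a \<in> borel_measurable borel"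
    using \<open>A \<in> sets borel\<close> unfolding b_def a_def
    by (auto intro!: borel_measurable_indicator)
  have bT: "b (- T y) = b y" for y
    using T by (simp add: b_def indicator_def orthogonal_transformation_norm)
  have B: "(\<integral>\<^sup>+x. b x \<partial>lborel) = emeasure lborel (ball (0::'a) 1)"
    by (simp add: b_def)
  have "emeasure (distr lborel borel T) A = (\<integral>\<^sup>+y. a (T y) \<partial>lborel)"
  proof -
    have "(\<integral>\<^sup>+y. a (T y) \<partial>lborel) = (\<integral>\<^sup>+y. a y \<partial>distr lborel borel T)"
      by (rule nn_integral_distr[symmetric]) auto
    then show ?thesis
      by (simp add: a_def)
  qed
  \<comment> \<open>Each integral over \<open>y\<close> is shifted by \<open>S x\<close>, a preimage of \<open>x\<close>; each one over \<open>x\<close> by \<open>T y\<close>.\<close>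
  then have "emeasure lborel (ball (0::'a) 1) * emeasure (distr lborel borel T) A
      = (\<integral>\<^sup>+x. b x * (\<integral>\<^sup>+y. a (T y) \<partial>lborel) \<partial>lborel)"
    by (simp add: B nn_integral_multc)
  also have "\<dots> = (\<integral>\<^sup>+x. (\<integral>\<^sup>+y. b x * a (x + T y) \<partial>lborel) \<partial>lborel)"
  proof (rule nn_integral_cong)
    fix x
    have "(\<integral>\<^sup>+y. a (T y) \<partial>lborel) = (\<integral>\<^sup>+y. a (T (S x + y)) \<partial>lborel)"
      by (rule nn_integral_lborel_translate[symmetric]) simp
    then show "b x * (\<integral>\<^sup>+y. a (T y) \<partial>lborel) = (\<integral>\<^sup>+y. b x * a (x + T y) \<partial>lborel)"
      by (simp add: add TS nn_integral_cmult)
  qed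
  also have "\<dots> = (\<integral>\<^sup>+y. (\<integral>\<^sup>+x. b x * a (x + T y) \<partial>lborel) \<partial>lborel)"
    by (rule lborel_pair.Fubini'[symmetric]) simp
  also have "\<dots> = (\<integral>\<^sup>+y. (\<integral>\<^sup>+x. b (x - T y) * a x \<partial>lborel) \<partial>lborel)"
  proof (rule nn_integral_cong)
    fix y
    show "(\<integral>\<^sup>+x. b x * a (x + T y) \<partial>lborel) = (\<integral>\<^sup>+x. b (x - T y) * a x \<partial>lborel)"
      using nn_integral_lborel_translate[of "\<lambda>x. b (x - T y) * a x" "T y"]
      by (simp add: add.commute)
  qed
  also have "\<dots> = (\<integral>\<^sup>+x. (\<integral>\<^sup>+y. b (x - T y) * a x \<partial>lborel) \<partial>lborel)"
    by (rule lborel_pair.Fubini') simp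
  also have "\<dots> = (\<integral>\<^sup>+x. emeasure lborel (ball (0::'a) 1) * a x \<partial>lborel)"
  proof (rule nn_integral_cong)
    fix x
    have "(\<integral>\<^sup>+y. b (x - T y) \<partial>lborel) = (\<integral>\<^sup>+y. b (x - T (S x + y)) \<partial>lborel)"
      by (rule nn_integral_lborel_translate[symmetric]) simp
    also have "\<dots> = emeasure lborel (ball (0::'a) 1)"
      by (simp add: add TS bT B)
    finally show "(\<integral>\<^sup>+y. b (x - T y) * a x \<partial>lborel) = emeasure lborel (ball (0::'a) 1) * a x"
      by (simp add: nn_integral_multc)
  qed
  also have "\<dots> = emeasure lborel (ball (0::'a) 1) * emeasure lborel A"
    by (simp add: nn_integral_cmult a_def)
  finally have eq: "emeasure lborel (ball (0::'a) 1) * emeasure (distr lborel borel T) A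
      = emeasure lborel (ball (0::'a) 1) * emeasure lborel A" .
  have "emeasure lborel (ball (0::'a) 1) \<noteq> 0"
    using open_not_negligible[of "ball (0::'a) 1"]
    by (auto simp: negligible_iff_null_sets null_sets_def)
  moreover have "emeasure lborel (ball (0::'a) 1) \<noteq> \<infinity>"
    using emeasure_lborel_ball_finite[of "0::'a" 1] by simp
  ultimately show "emeasure (distr lborel borel T) A = emeasure lborel A"
    using eq by (simp add: ennreal_mult_cancel_left)
qed simp

lemma
  fixes T :: "'a::euclidean_space \<Rightarrow> 'a"
  assumes T: "orthogonal_transformation T"
  shows lebesgue_measurable_orthogonal_transformation: "T \<in> lebesgue \<rightarrow>\<^sub>M lebesgue"
    and lebesgue_distr_orthogonal_transformation: "distr lebesgue lebesgue T = lebesgue"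
proof -
  have T_borel: "T \<in> lborel \<rightarrow>\<^sub>M lborel"
    using borel_measurable_orthogonal_transformation[OF T] by simp
  have "distr lebesgue lborel T = distr lborel lborel T"
    using T_borel by (rule distr_completion)
  also have "\<dots> = lborel"
    using lborel_distr_orthogonal_transformation[OF T] by (simp cong: distr_cong)
  finally have eq: "distr lebesgue lborel T = lborel" .
  have T_meas: "T \<in> lebesgue \<rightarrow>\<^sub>M lborel"
    using T_borel by (rule measurable_completion)
  show "T \<in> lebesgue \<rightarrow>\<^sub>M lebesgue"
    using T_meas by (rule completion.measurable_completion2) (simp add: eq)
  show "distr lebesgue lebesgue T = lebesgue"
    using completion.completion_distr_eq[OF T_meas] by (simp add: eq)
qed

text \<open>
  Since the inverse of \<open>T\<close> is orthogonal as well, \<open>f\<close> is integrable exactly when \<open>f \<circ> T\<close> is. Hence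
  the identity holds for every \<open>f\<close>: if either side fails to be integrable, both integrals have the
  default value 0. In this form the identity applies directly to the singular integral against the
  jump kernel.
\<close>
lemma lebesgue_integral_orthogonal_transformation:
  fixes T :: "'a::euclidean_space \<Rightarrow> 'a"
    and f :: "'a \<Rightarrow> 'b::{banach, second_countable_topology}"
  assumes T: "orthogonal_transformation T"
  shows "(LINT x|lebesgue. f (T x)) = (LINT x|lebesgue. f x)"
proof -
  have pullback: "integrable lebesgue (\<lambda>x. g (R x))"
    if "orthogonal_transformation R" "integrable lebesgue g" for R :: "'a \<Rightarrow> 'a" and g :: "'a \<Rightarrow> 'b"
    using integrable_distr[OF lebesgue_measurable_orthogonal_transformation, of R g] that
    by (simp add: lebesgue_distr_orthogonal_transformation)
  have T_inv: "T (inv T x) = x" for x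
    using orthogonal_transformation_surj[OF T] by (rule surj_f_inv_f)
  show ?thesis
  proof (rule integral_eq_cases)
    show "integrable lebesgue (\<lambda>x. f (T x)) \<longleftrightarrow> integrable lebesgue f"
      using pullback[OF T, of f]
        pullback[OF orthogonal_transformation_inv[OF T], of "\<lambda>x. f (T x)"]
      by (auto simp: T_inv)
    assume "integrable lebesgue f"
    then have "f \<in> borel_measurable lebesgue"
      by (rule borel_measurable_integrable)
    then show "(LINT x|lebesgue. f (T x)) = (LINT x|lebesgue. f x)"
      using integral_distr[OF lebesgue_measurable_orthogonal_transformation[OF T], of f]
      by (simp add: lebesgue_distr_orthogonal_transformation[OF T])
  qed
qed

lemma second_diff_orthogonal_invariant:
  fixes T :: "'a::real_inner \<Rightarrow> 'a"
  assumes "orthogonal_transformation T" and "\<And>z. f (T z) = f z"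
  shows "second_diff (T h) f (T x) = second_diff h f x"
proof -
  have "linear T"
    using assms(1) by (rule orthogonal_transformation_linear)
  then have "T x + T h = T (x + h)" "T x - T h = T (x - h)"
    by (simp_all add: linear_add linear_diff)
  then show ?thesis
    by (simp add: second_diff_def assms(2))
qed

lemma pointwise_potential_orthogonal_invariant:
  fixes T :: "real ^ 'n \<Rightarrow> real ^ 'n"
  assumes T: "orthogonal_transformation T" and f: "\<And>z. f (T z) = f z"
  shows "pointwise_potential m f (T x) = pointwise_potential m f x"
proof -
  have "(LINT h|lebesgue. second_diff h f (T x) * jump_kernel CARD('n) m (norm h))
      = (LINT h|lebesgue. second_diff (T h) f (T x) * jump_kernel CARD('n) m (norm (T h)))"
    by (rule lebesgue_integral_orthogonal_transformation[OF T, symmetric])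
  also have "\<dots> = (LINT h|lebesgue. second_diff h f x * jump_kernel CARD('n) m (norm h))"
    by (simp add: second_diff_orthogonal_invariant[of T f, OF T f] orthogonal_transformation_norm[OF T])
  finally show ?thesis
    by (simp add: pointwise_potential_def f)
qed

theorem theorem7p1:
  fixes \<Phi> \<mu> :: "real \<Rightarrow> real"
    and \<phi> V :: "real ^ 'n \<Rightarrow> real"
  assumes "complete_bernstein \<Phi> \<mu>"
    and "\<phi> \<in> L2_space" and "\<phi> \<in> Linf_space" and "\<And>x. \<phi> x > 0"
    and "schroedinger_op \<Phi> V (\<lambda>x. complex_of_real (\<phi> x)) (\<lambda>_. 0)"
    and "\<And>x. V x = pointwise_potential \<mu> \<phi> x"
    and "\<phi> \<in> Z_space" and "radially_symmetric \<phi>"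
  shows "\<exists>v :: real \<Rightarrow> real. \<forall>x. V x = v (norm x)"
proof -
  obtain \<rho> where \<rho>: "\<phi> x = \<rho> (norm x)" for x
    using assms(8) unfolding radially_symmetric_def by blast
  have V_eq: "V x = V y" if xy: "norm x = norm y" for x y
  proof -
    obtain T where T: "orthogonal_transformation T" and "T x = y"
      using orthogonal_transformation_exists[OF xy] by blast
    moreover have "\<phi> (T z) = \<phi> z" for z
      by (simp add: \<rho> orthogonal_transformation_norm[OF T])
    ultimately show ?thesis
      using pointwise_potential_orthogonal_invariant[of T \<phi> \<mu> x] by (simp add: assms(6))
  qed
  have "V x = V (SOME y. norm y = norm x)" for x
    by (rule V_eq) (rule someI[of "\<lambda>y. norm y = norm x" x, symmetric], rule refl)
  then show ?thesis
    by (intro exI[of _ "\<lambda>r. V (SOME y. norm y = r)"] allI)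
qed

end
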